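(* Let $V=\{z\in(\mathbb C^* )^n\mid f(z)=0\}$ be a smooth hypersurface, with $f\in\mathbb C[z_1^{\pm1},\dots,z_n^{\pm1}]$, let $\Sigma=\operatorname{Crit}(\operatorname{Log}|_V)$ and let $\gamma_{\log}:V\to\mathbb P^{n-1}$ be the logarithmic Gauss map. Then $$\Sigma=\gamma_{\log}^{-1}(\mathbb{RP}^{n-1}).$$ Equivalently, a point $q\in V$ lies in $\Sigma$ if and only if $$F_j(q)\overline{F_k(q)}-\overline{F_j(q)}F_k(q)=0\qquad\text{for every }1\le j<k\le n.$$ In real coordinates $z_j=x_j+iy_j$, the critical locus $\Sigma$ is therefore a real algebraic subset of $(\mathbb R^2\setminus\{0\})^n$, defined by $\operatorname{Re}f=0$, $\operatorname{Im}f=0$ and $\operatorname{Im}(F_j\overline{F_k})=0$ for all $1\le j<k\le n$. Moreover, for each $\ell\in\{1,\dots,n\}$, on the affine chart $U_\ell=\{q\in V\mid F_\ell(q)\ne0\}$ it is enough to impose the $n-1$ equations $\rho_j^{(\ell)}=\operatorname{Im}(F_j\overline{F_\ell})=0$, $j\ne\ell$; that is, $$\Sigma\cap U_\ell=\{q\in U_\ell\mid \rho_j^{(\ell)}(q)=0\text{ for every }j\ne\ell\}.$$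
   Context: $n$ is a positive integer, and $f\in\mathbb C[z_1^{\pm1},\dots,z_n^{\pm1}]$ is a Laurent polynomial. The hypersurface $V=\{f=0\}\subset(\mathbb C^* )^n$ is smooth in the sense that the partial derivatives of $f$ do not vanish simultaneously at any point of $V$. The logarithmic map is $\operatorname{Log}:(\mathbb C^* )^n\to\mathbb R^n$, $\operatorname{Log}(z)=(\log|z_1|,\dots,\log|z_n|)$. The critical locus $\operatorname{Crit}(\operatorname{Log}|_V)$ is the set of points of $V$ at which the real differential of $\operatorname{Log}|_V:V\to\mathbb R^n$ is not surjective. Put $F_j=z_j\,\partial f/\partial z_j$ for $1\le j\le n$; these do not vanish simultaneously on $V$, and the logarithmic Gauss map is $\gamma_{\log}(z)=[F_1(z):\cdots:F_n(z)]\in\mathbb P^{n-1}=\mathbb{CP}^{n-1}$. Laurent monomials are regarded as real rational expressions in the $x_j,y_j$ with denominators that do not vanish on $(\mathbb C^* )^n$; after clearing these denominators the equations are polynomial. *)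

theory Defs
  imports "HOL-Analysis.Analysis" "HOL-Library.Poly_Mapping"
begin

text \<open>A Laurent polynomial in the variables \<open>z\<^sub>j\<close> (\<open>j :: 'n\<close>) is an element of the
  group algebra of \<open>\<int>\<^sup>n\<close>: a finitely supported family of coefficients indexed by exponent vectors.\<close>

type_synonym 'n laurent = "(int ^ 'n) \<Rightarrow>\<^sub>0 complex"

definition leval :: "'n::finite laurent \<Rightarrow> complex ^ 'n \<Rightarrow> complex" where
  "leval f z = (\<Sum>\<alpha>\<in>Poly_Mapping.keys f. Poly_Mapping.lookup f \<alpha> * (\<Prod>j\<in>UNIV. (z $ j) powi (\<alpha> $ j)))"

definition torus :: "(complex ^ 'n::finite) set" where
  "torus = {z. \<forall>j. z $ j \<noteq> 0}"

text \<open>\<open>leval f\<close> is holomorphic in each variable on the torus, so \<open>partial j f z\<close> is there the value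
  of the formal partial derivative.\<close>

definition partial :: "'n::finite \<Rightarrow> 'n laurent \<Rightarrow> complex ^ 'n \<Rightarrow> complex" where
  "partial j f z = deriv (\<lambda>w. leval f (\<chi> i. if i = j then w else z $ i)) (z $ j)"

definition hypersurface :: "'n::finite laurent \<Rightarrow> (complex ^ 'n) set" where
  "hypersurface f = {z \<in> torus. leval f z = 0}"

definition smooth_hypersurface :: "'n::finite laurent \<Rightarrow> bool" where
  "smooth_hypersurface f \<longleftrightarrow> (\<forall>z\<in>hypersurface f. \<exists>j. partial j f z \<noteq> 0)"

definition Log :: "complex ^ 'n::finite \<Rightarrow> real ^ 'n" where
  "Log z = (\<chi> j. ln (cmod (z $ j)))"

text \<open>The tangent space of an embedded submanifold \<open>S\<close> of a normed space, as the set of velocities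
  of \<open>C\<^sup>1\<close> curves in \<open>S\<close>.\<close>

definition tangent_space :: "'a::real_normed_vector set \<Rightarrow> 'a \<Rightarrow> 'a set" where
  "tangent_space S q = {v. \<exists>c e. e > 0 \<and> c C1_differentiable_on {-e<..<e} \<and>
     c ` {-e<..<e} \<subseteq> S \<and> c 0 = q \<and> (c has_vector_derivative v) (at 0)}"

text \<open>For \<open>g\<close> differentiable near \<open>S\<close>, the differential of \<open>g\<close> restricted to \<open>S\<close> at \<open>q\<close> is the
  restriction of the Frechet derivative of \<open>g\<close> to the tangent space of \<open>S\<close>.\<close>

definition critical_locus ::
    "('a::real_normed_vector \<Rightarrow> 'b::real_normed_vector) \<Rightarrow> 'a set \<Rightarrow> 'a set" where
  "critical_locus g S = {q \<in> S. frechet_derivative g (at q) ` tangent_space S q \<noteq> UNIV}"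

definition log_partial :: "'n::finite laurent \<Rightarrow> 'n \<Rightarrow> complex ^ 'n \<Rightarrow> complex" where
  "log_partial f j z = z $ j * partial j f z"

text \<open>Points of \<open>\<complex>\<P>\<^sup>n\<^sup>-\<^sup>1\<close> are classes of nonzero vectors modulo nonzero scalars.
  The junk value \<open>homog 0 = {}\<close> lies outside \<open>complex_proj_space\<close>.\<close>

definition proj_rel :: "((complex ^ 'n::finite) \<times> (complex ^ 'n)) set" where
  "proj_rel = {(v, w). v \<noteq> 0 \<and> w \<noteq> 0 \<and> (\<exists>c. c \<noteq> 0 \<and> w = c *s v)}"

definition complex_proj_space :: "(complex ^ 'n::finite) set set" where
  "complex_proj_space = {v. v \<noteq> 0} // proj_rel"

definition homog :: "complex ^ 'n::finite \<Rightarrow> (complex ^ 'n) set" where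
  "homog v = proj_rel `` {v}"

definition real_proj_space :: "(complex ^ 'n::finite) set set" where
  "real_proj_space = {homog (\<chi> j. complex_of_real (x $ j)) | x :: real ^ 'n. x \<noteq> 0}"

definition log_gauss :: "'n::finite laurent \<Rightarrow> complex ^ 'n \<Rightarrow> (complex ^ 'n) set" where
  "log_gauss f z = homog (\<chi> j. log_partial f j z)"

lemma equiv_proj_rel: "equiv {v :: complex ^ 'n::finite. v \<noteq> 0} proj_rel"
proof (rule equivI)
  have 1: "(v, v) \<in> proj_rel" if "v \<noteq> 0" for v :: "complex ^ 'n"
    unfolding proj_rel_def using that by (simp, intro exI[of _ 1]) simp
  show "proj_rel \<subseteq> {v :: complex ^ 'n. v \<noteq> 0} \<times> {v. v \<noteq> 0}"
    by (auto simp: proj_rel_def)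
  show "refl_on {v :: complex ^ 'n. v \<noteq> 0} proj_rel"
    using 1 by (simp add: refl_on_def)
  show "sym (proj_rel :: ((complex ^ 'n) \<times> _) set)"
  proof (rule symI)
    fix v w :: "complex ^ 'n"
    assume "(v, w) \<in> proj_rel"
    then obtain c where c: "v \<noteq> 0" "w \<noteq> 0" "c \<noteq> 0" "w = c *s v"
      by (auto simp: proj_rel_def)
    have "inverse c \<noteq> 0 \<and> v = inverse c *s w"
      using c(3,4) by (simp add: vec_eq_iff)
    with c(1,2) show "(w, v) \<in> proj_rel"
      unfolding proj_rel_def by blast
  qed
  show "trans (proj_rel :: ((complex ^ 'n) \<times> _) set)"
  proof (rule transI)
    fix u v w :: "complex ^ 'n"
    assume "(u, v) \<in> proj_rel" "(v, w) \<in> proj_rel"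
    then obtain c d where *: "u \<noteq> 0" "w \<noteq> 0" "c \<noteq> 0" "d \<noteq> 0" "v = c *s u" "w = d *s v"
      by (auto simp: proj_rel_def)
    have "d * c \<noteq> 0 \<and> w = (d * c) *s u"
      using *(3-6) by (simp add: vec_eq_iff)
    with *(1,2) show "(u, w) \<in> proj_rel"
      unfolding proj_rel_def by blast
  qed
qed

lemma homog_in_complex_proj_space: "v \<noteq> 0 \<Longrightarrow> homog v \<in> complex_proj_space"
  by (simp add: homog_def complex_proj_space_def quotientI)

lemma real_proj_space_subset: "real_proj_space \<subseteq> complex_proj_space"
  unfolding real_proj_space_def
  by (auto simp: vec_eq_iff intro!: homog_in_complex_proj_space)

lemma log_gauss_in_complex_proj_space:
  assumes "smooth_hypersurface f" "z \<in> hypersurface f"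
  shows "log_gauss f z \<in> complex_proj_space"
proof -
  obtain j where "partial j f z \<noteq> 0" "z $ j \<noteq> 0"
    using assms by (auto simp: smooth_hypersurface_def hypersurface_def torus_def)
  then have "(\<chi> j. log_partial f j z) \<noteq> 0"
    by (auto simp: vec_eq_iff log_partial_def)
  then show ?thesis
    by (simp add: log_gauss_def homog_in_complex_proj_space)
qed

definition of_real_coords :: "(real \<times> real) ^ 'n::finite \<Rightarrow> complex ^ 'n" where
  "of_real_coords w = (\<chi> j. Complex (fst (w $ j)) (snd (w $ j)))"

definition real_torus :: "((real \<times> real) ^ 'n::finite) set" where
  "real_torus = {w. \<forall>j. w $ j \<noteq> 0}"

text \<open>On \<open>(real \<times> real) ^ 'n\<close>, \<open>real_polynomial_function\<close> means a real polynomial in the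
  coordinates \<open>x\<^sub>j\<close>, \<open>y\<^sub>j\<close>. On \<open>T\<close>, \<open>g\<close> becomes polynomial after clearing a denominator that has no zero on \<open>T\<close>.\<close>

definition polynomial_up_to_denominator ::
    "'a::real_normed_vector set \<Rightarrow> ('a \<Rightarrow> real) \<Rightarrow> bool" where
  "polynomial_up_to_denominator T g \<longleftrightarrow> (\<exists>p d. real_polynomial_function p \<and>
     real_polynomial_function d \<and> (\<forall>w\<in>T. d w \<noteq> 0 \<and> d w * g w = p w))"

definition real_algebraic_subset ::
    "'a::real_normed_vector set \<Rightarrow> 'a set \<Rightarrow> bool" where
  "real_algebraic_subset T S \<longleftrightarrow> (\<exists>P. finite P \<and> (\<forall>p\<in>P. real_polynomial_function p) \<and>
     S = {w \<in> T. \<forall>p\<in>P. p w = 0})"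

end

theory Submission
  imports Defs
begin

text \<open>Write a tangent vector \<open>v\<close> at \<open>z\<close> in logarithmic coordinates \<open>w\<^sub>j = v\<^sub>j / z\<^sub>j\<close>. Since
  \<open>df(v) = \<Sum> F\<^sub>j(z) w\<^sub>j\<close>, the tangent space of \<open>V\<close> becomes the complex hyperplane
  \<open>\<Sum> F\<^sub>j(z) w\<^sub>j = 0\<close> (\<open>tangent_space_hypersurface\<close>), and the differential of \<open>Log\<close> becomes
  \<open>w \<mapsto> Re w\<close> (\<open>has_derivative_Log\<close>). So \<open>z\<close> is critical iff the real parts of the vectors of this
  hyperplane do not fill \<open>\<real>\<^sup>n\<close>.

  A real vector \<open>x\<close> is such a real part iff \<open>\<Sum> F\<^sub>j x\<^sub>j + i \<Sum> F\<^sub>j y\<^sub>j = 0\<close> for some real \<open>y\<close>. If two of the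
  \<open>F\<^sub>j\<close> are linearly independent over \<open>\<real>\<close>, the second sum takes every complex value, and \<open>z\<close> is regular. If
  all \<open>F\<^sub>j\<close> lie on one real line in \<open>\<complex>\<close>, the hyperplane has a real equation, the real parts satisfy it
  too, and \<open>z\<close> is critical (\<open>real_parts_of_hyperplane_UNIV_iff\<close>). Lying on one real line is the
  vanishing of all \<open>Im (F\<^sub>j * cnj F\<^sub>k)\<close>, it is the reality of the point \<open>[F\<^sub>1 : \<dots> : F\<^sub>n]\<close>, and if \<open>F\<^sub>l \<noteq> 0\<close>
  it can be tested against \<open>F\<^sub>l\<close> alone.

  The analytic part is that tangent vectors are velocities of curves: each vector
  in the kernel of \<open>df\<close> has to be realised by a \<open>C\<^sup>1\<close> curve in \<open>V\<close>, which the inverse function theorem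
  provides (\<open>tangent_space_regular_zero_set\<close>). The algebraic part is that \<open>F\<^sub>j\<close> is again
  a Laurent polynomial, and that the real and imaginary parts of Laurent polynomials are rational
  functions of the real coordinates with denominators that have no zeros on the torus.\<close>

section \<open>Tangent spaces of regular zero sets\<close>

lemma norm_le_of_near_id_blinfun:
  fixes A :: "'b::real_normed_vector \<Rightarrow>\<^sub>L 'b"
  assumes "dist A id_blinfun \<le> 1/2"
  shows "norm x \<le> 2 * norm (blinfun_apply A x)"
proof -
  have "norm (blinfun_apply (A - id_blinfun) x) \<le> norm (A - id_blinfun) * norm x"
    by (rule norm_blinfun)
  also have "\<dots> \<le> 1/2 * norm x"
    using assms by (intro mult_right_mono) (auto simp: dist_norm)
  finally have "norm (blinfun_apply A x - x) \<le> norm x / 2"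
    by (simp add: blinfun.diff_left)
  then show ?thesis
    using norm_triangle_sub[of x "blinfun_apply A x"] by (simp add: norm_minus_commute)
qed

text \<open>Solutions of a linear equation with a fixed right-hand side vary continuously with an operator near
  the identity: \<open>A t (u t - u s) = - (A t - A s) (u s)\<close>, and near the
  identity a vector is at most twice as long as its image, so that the solution varies no more
  than the operator does.\<close>

lemma continuous_on_solution_near_id:
  fixes A :: "'x::topological_space \<Rightarrow> ('b::real_normed_vector \<Rightarrow>\<^sub>L 'b)"
  assumes cont: "continuous_on S A"
    and near: "\<And>t. t \<in> S \<Longrightarrow> dist (A t) id_blinfun \<le> 1/2"
    and sol: "\<And>t. t \<in> S \<Longrightarrow> blinfun_apply (A t) (u t) = w"
  shows "continuous_on S u"
  unfolding continuous_on_def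
proof
  fix s assume s: "s \<in> S"
  have bound: "norm (u t - u s) \<le> norm (A t - A s) * (2 * norm (u s))" if "t \<in> S" for t
  proof -
    have "norm (u t - u s) \<le> 2 * norm (blinfun_apply (A t) (u t - u s))"
      using norm_le_of_near_id_blinfun near that by blast
    also have "blinfun_apply (A t) (u t - u s) = - blinfun_apply (A t - A s) (u s)"
      using sol[OF s] sol[OF that] by (simp add: blinfun.diff_right blinfun.diff_left)
    also have "2 * norm \<dots> \<le> 2 * (norm (A t - A s) * norm (u s))"
      using norm_blinfun[of "A t - A s" "u s"] by simp
    finally show ?thesis by (simp add: mult_ac)
  qed
  have "(A \<longlongrightarrow> A s) (at s within S)"
    using cont s by (auto simp: continuous_on_def)
  then have "((\<lambda>t. norm (A t - A s)) \<longlongrightarrow> 0) (at s within S)"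
    by (metis LIM_zero tendsto_norm_zero)
  then have lim: "((\<lambda>t. norm (A t - A s) * (2 * norm (u s))) \<longlongrightarrow> 0) (at s within S)"
    by (rule tendsto_mult_left_zero)
  have "((\<lambda>t. u t - u s) \<longlongrightarrow> 0) (at s within S)"
    by (rule Lim_null_comparison[OF _ lim]) (auto simp: eventually_at_filter bound)
  then show "(u \<longlongrightarrow> u s) (at s within S)"
    by (rule LIM_zero_cancel)
qed

text \<open>The chain rule puts every velocity of a curve in the zero set into the kernel of the derivative.
  For the converse, a kernel vector \<open>v\<close> must be realised by a \<open>C\<^sup>1\<close> curve. The straight line
  \<open>q + t v\<close> satisfies the equation up to \<open>o(t)\<close> and is corrected along a linear right inverse
  \<open>R\<close> of \<open>g' q\<close>: the map \<open>(t, s) \<mapsto> (t, g (q + t v + R s))\<close> has derivative the identity at \<open>0\<close>,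
  because \<open>g' q v = 0\<close> and \<open>g' q (R s) = s\<close>. The preimage of the axis \<open>s = 0\<close> under it, carried
  back by \<open>(t, s) \<mapsto> q + t v + R s\<close>, is the curve.\<close>

theorem tangent_space_regular_zero_set:
  fixes g :: "'a::euclidean_space \<Rightarrow> 'b::euclidean_space" and g' :: "'a \<Rightarrow> 'a \<Rightarrow>\<^sub>L 'b"
  assumes "open U"
    and der: "\<And>x. x \<in> U \<Longrightarrow> (g has_derivative blinfun_apply (g' x)) (at x)"
    and cont: "continuous_on U g'"
    and "q \<in> U" "g q = 0"
    and surj: "surj (blinfun_apply (g' q))"
  shows "tangent_space {x \<in> U. g x = 0} q = {v. blinfun_apply (g' q) v = 0}"
proof (intro equalityI subsetI)
  fix v assume "v \<in> tangent_space {x \<in> U. g x = 0} q"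
  then obtain c e where e: "e > 0" and c: "c ` {-e<..<e} \<subseteq> {x \<in> U. g x = 0}" "c 0 = q"
    and cv: "(c has_vector_derivative v) (at (0::real))"
    by (auto simp: tangent_space_def)
  have zero: "g (c t) = 0" if "t \<in> {-e<..<e}" for t
    using c(1) that by (auto simp: image_subset_iff)
  have "(c has_derivative (\<lambda>t. t *\<^sub>R v)) (at 0)"
    using cv by (simp add: has_vector_derivative_def)
  from has_derivative_compose[OF this] der[OF \<open>q \<in> U\<close>] \<open>c 0 = q\<close>
  have "((\<lambda>t. g (c t)) has_derivative (\<lambda>t. blinfun_apply (g' q) (t *\<^sub>R v))) (at 0)"
    by simp
  moreover have "((\<lambda>t. g (c t)) has_derivative (\<lambda>t. 0)) (at 0)"
    by (rule has_derivative_transform_within_open[of "\<lambda>_. 0" _ _ _ "{-e<..<e}"])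
      (use e zero in auto)
  ultimately have "(\<lambda>t. blinfun_apply (g' q) (t *\<^sub>R v)) = (\<lambda>t. 0)"
    by (rule has_derivative_unique)
  from fun_cong[OF this, of 1] show "v \<in> {v. blinfun_apply (g' q) v = 0}" by simp
next
  fix v assume "v \<in> {v. blinfun_apply (g' q) v = 0}"
  then have v: "blinfun_apply (g' q) v = 0" by simp
  obtain R where "linear R" and R: "blinfun_apply (g' q) \<circ> R = id"
    using linear_surjective_right_inverse[OF bounded_linear.linear[OF blinfun.bounded_linear_right] surj] by blast
  have R': "blinfun_apply (g' q) (R b) = b" for b
    using fun_cong[OF R, of b] by simp
  define L where "L p = fst p *\<^sub>R v + R (snd p)" for p :: "real \<times> 'b"
  have "linear L"
    by (rule linearI) (auto simp: L_def linear_add[OF \<open>linear R\<close>] linear_cmul[OF \<open>linear R\<close>] algebra_simps)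
  then have blL: "bounded_linear L" by (rule linear_conv_bounded_linear[THEN iffD1])
  note contL = bounded_linear.continuous_on[OF blL]
  define \<Phi> where "\<Phi> p = (fst p, g (q + L p))" for p :: "real \<times> 'b"
  define D where "D p = Blinfun (\<lambda>h. (fst h, blinfun_apply (g' (q + L p)) (L h)))" for p
  have D: "blinfun_apply (D p) = (\<lambda>h. (fst h, blinfun_apply (g' (q + L p)) (L h)))" for p
    unfolding D_def
    by (intro bounded_linear_Blinfun_apply bounded_linear_Pair bounded_linear_fst
        bounded_linear_compose[OF blinfun.bounded_linear_right blL])
  define W where "W = (\<lambda>p. q + L p) -` U"
  have "open W"
    unfolding W_def using \<open>open U\<close> by (intro open_vimage) (auto intro!: continuous_intros contL)
  have contD: "continuous_on W D"
  proof (rule continuous_on_blinfun_componentwise)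
    fix i :: "real \<times> 'b"
    have "continuous_on W (\<lambda>p. g' (q + L p))"
      by (rule continuous_on_compose2[OF cont]) (auto simp: W_def intro!: continuous_intros contL)
    then show "continuous_on W (\<lambda>p. blinfun_apply (D p) i)"
      unfolding D by (intro continuous_intros)
  qed
  have D0: "D 0 = id_blinfun"
    by (rule blinfun_eqI) (auto simp: D L_def linear_0[OF \<open>linear R\<close>] blinfun.add_right blinfun.scaleR_right v R')
  \<comment> \<open>This closeness to the identity makes the velocity \<open>u\<close> below continuous.\<close>
  define W\<^sub>0 where "W\<^sub>0 = W \<inter> D -` ball id_blinfun (1/2)"
  have "open W\<^sub>0"
    unfolding W\<^sub>0_def using contD \<open>open W\<close> by (rule continuous_open_preimage) simp
  have "L 0 = 0" using \<open>linear L\<close> by (rule linear_0)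
  have "0 \<in> W\<^sub>0"
    using \<open>q \<in> U\<close> D0 by (simp add: W\<^sub>0_def W_def \<open>L 0 = 0\<close>)
  have \<Phi>0: "\<Phi> 0 = 0" by (simp add: \<Phi>_def zero_prod_def[symmetric] \<open>L 0 = 0\<close> \<open>g q = 0\<close>)
  have der\<Phi>: "(\<Phi> has_derivative blinfun_apply (D p)) (at p)" if "p \<in> W\<^sub>0" for p
  proof -
    have "((\<lambda>p. q + L p) has_derivative L) (at p)"
      by (auto intro!: derivative_eq_intros bounded_linear_imp_has_derivative blL)
    moreover have "q + L p \<in> U" using that by (simp add: W\<^sub>0_def W_def)
    ultimately have "((\<lambda>p. g (q + L p)) has_derivative (\<lambda>h. blinfun_apply (g' (q + L p)) (L h))) (at p)"
      by (rule has_derivative_compose[OF _ der])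
    then show ?thesis
      unfolding \<Phi>_def D
      by (rule has_derivative_Pair[OF bounded_linear_imp_has_derivative[OF bounded_linear_fst]])
  qed
  have contD0: "continuous_on W\<^sub>0 D"
    using contD by (rule continuous_on_subset) (simp add: W\<^sub>0_def)
  obtain U' V h h' where U': "U' \<subseteq> W\<^sub>0" "0 \<in> U'" and V: "open V" "0 \<in> V"
    and hom: "homeomorphism U' V \<Phi> h"
    and derh: "\<And>y. y \<in> V \<Longrightarrow> (h has_derivative h' y) (at y)"
    and h': "\<And>y. y \<in> V \<Longrightarrow> h' y = inv (blinfun_apply (D (h y)))"
    and bij: "\<And>y. y \<in> V \<Longrightarrow> bij (blinfun_apply (D (h y)))"
    using inverse_function_theorem_scaled[OF \<open>open W\<^sub>0\<close> der\<Phi> contD0 \<open>0 \<in> W\<^sub>0\<close> \<Phi>0 D0] by metis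
  define j where "j t = (t, 0::'b)" for t :: real
  have "open (j -` V)"
    using V(1) by (intro open_vimage) (auto simp: j_def intro!: continuous_intros)
  moreover have "0 \<in> j -` V" using V(2) by (simp add: j_def zero_prod_def)
  ultimately obtain e where "e > 0" and e: "ball 0 e \<subseteq> j -` V"
    by (meson open_contains_ball)
  define I where "I = {-e<..<e}"
  have jV: "j t \<in> V" if "t \<in> I" for t
    using subsetD[OF e, of t] that by (simp add: I_def dist_real_def abs_less_iff)
  have hW: "h (j t) \<in> W\<^sub>0" and \<Phi>h: "\<Phi> (h (j t)) = j t" if "t \<in> I" for t
    using homeomorphism_image2[OF hom] homeomorphism_apply2[OF hom] jV[OF that] U'(1) by blast+
  \<comment> \<open>The velocity of \<open>h (j t)\<close>: its image under the derivative of \<open>\<Phi>\<close> is the velocity of \<open>j\<close>.\<close>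
  define u where "u t = h' (j t) (1, 0)" for t
  have Du: "blinfun_apply (D (h (j t))) (u t) = (1, 0)" if "t \<in> I" for t
    using bij[OF jV[OF that]] h'[OF jV[OF that]] by (simp add: u_def bij_is_surj surj_f_inv_f)
  have hj0: "h (j 0) = 0"
    using homeomorphism_apply1[OF hom U'(2)] \<Phi>0 by (simp add: j_def zero_prod_def)
  have dj: "(j has_derivative (\<lambda>t. (t, 0))) (at t)" for t
    unfolding j_def by (auto intro!: derivative_eq_intros)
  have derhj: "((\<lambda>t. h (j t)) has_vector_derivative u t) (at t)" if "t \<in> I" for t
  proof -
    have "linear (h' (j t))" using derh[OF jV[OF that]] by (rule has_derivative_linear)
    then have "h' (j t) (s, 0) = s *\<^sub>R u t" for s
      using linear_cmul[of "h' (j t)" s "(1,0)"] by (simp add: u_def)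
    with has_derivative_compose[OF dj derh[OF jV[OF that]]] show ?thesis
      by (simp add: has_vector_derivative_def)
  qed
  have "continuous_on I (\<lambda>t. h (j t))"
    by (intro continuous_at_imp_continuous_on ballI has_vector_derivative_continuous[OF derhj])
  then have "continuous_on I (\<lambda>t. D (h (j t)))"
    by (rule continuous_on_compose2[OF contD0]) (simp add: image_subset_iff hW)
  then have contu: "continuous_on I u"
    by (rule continuous_on_solution_near_id[where w = "(1, 0)"])
      (use hW in \<open>simp_all add: Du W\<^sub>0_def dist_commute less_imp_le\<close>)
  define c where "c t = q + L (h (j t))" for t
  have derc: "(c has_vector_derivative L (u t)) (at t)" if "t \<in> I" for t
    unfolding c_def using bounded_linear.has_vector_derivative[OF blL derhj[OF that]]
    by (auto intro!: derivative_eq_intros)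
  have "0 \<in> I" using \<open>e > 0\<close> by (simp add: I_def)
  have "c C1_differentiable_on I"
    unfolding C1_differentiable_on_def
    by (intro exI[of _ "\<lambda>t. L (u t)"] conjI ballI derc contL contu)
  moreover have "c ` I \<subseteq> {x \<in> U. g x = 0}"
    using hW \<Phi>h by (auto simp: W\<^sub>0_def W_def \<Phi>_def c_def j_def)
  moreover have "c 0 = q" by (simp add: c_def hj0 \<open>L 0 = 0\<close>)
  moreover have "L (u 0) = v"
    using Du[OF \<open>0 \<in> I\<close>] by (simp add: hj0 D0 L_def linear_0[OF \<open>linear R\<close>])
  ultimately show "v \<in> tangent_space {x \<in> U. g x = 0} q"
    unfolding tangent_space_def mem_Collect_eq
    using \<open>e > 0\<close> derc[OF \<open>0 \<in> I\<close>]
    by (intro exI[of _ c] exI[of _ e]) (simp add: I_def)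
qed

section \<open>Logarithmic derivatives of Laurent polynomials\<close>

lemma open_torus: "open (torus :: (complex ^ 'n::finite) set)"
proof -
  have "torus = (\<Inter>j. {z :: complex ^ 'n. z $ j \<noteq> 0})"
    by (auto simp: torus_def)
  also have "open \<dots>"
    by (intro open_INT ballI open_Collect_neq continuous_intros) auto
  finally show ?thesis .
qed

text \<open>The operator \<open>z\<^sub>j \<partial>/\<partial>z\<^sub>j\<close> multiplies a monomial by its exponent. It maps Laurent polynomials to
  Laurent polynomials, so facts about values of Laurent polynomials, such as continuity and
  rationality in real coordinates, apply to the functions \<open>F\<^sub>j\<close> as well.\<close>

definition euler_op :: "'n::finite \<Rightarrow> 'n laurent \<Rightarrow> 'n laurent" where
  "euler_op j = Poly_Mapping.mapp (\<lambda>\<alpha> c. of_int (\<alpha> $ j) * c)"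

lemma leval_euler_op:
  "leval (euler_op j f) z =
    (\<Sum>\<alpha>\<in>Poly_Mapping.keys f. of_int (\<alpha> $ j) * (Poly_Mapping.lookup f \<alpha> * (\<Prod>i\<in>UNIV. (z $ i) powi (\<alpha> $ i))))"
proof -
  let ?g = "euler_op j f"
  have "leval ?g z = (\<Sum>\<alpha>\<in>Poly_Mapping.keys f. Poly_Mapping.lookup ?g \<alpha> * (\<Prod>i\<in>UNIV. (z $ i) powi (\<alpha> $ i)))"
    unfolding leval_def
    by (rule sum.mono_neutral_left) (auto simp: euler_op_def keys_mapp_subset in_keys_iff)
  also have "\<dots> = (\<Sum>\<alpha>\<in>Poly_Mapping.keys f. of_int (\<alpha> $ j) * (Poly_Mapping.lookup f \<alpha> * (\<Prod>i\<in>UNIV. (z $ i) powi (\<alpha> $ i))))"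
    by (rule sum.cong) (simp_all add: euler_op_def lookup_mapp mult.assoc)
  finally show ?thesis .
qed

text \<open>The monomials are eigenvectors of the logarithmic derivatives, so in the tangent coordinates
  \<open>v\<^sub>j / z\<^sub>j\<close> the coefficients of the derivative are again multiples of the monomial itself.\<close>

lemma has_derivative_monomial:
  fixes \<alpha> :: "int ^ 'n::finite" and z :: "complex ^ 'n"
  assumes "z \<in> torus"
  shows "((\<lambda>z. \<Prod>j\<in>UNIV. (z $ j) powi (\<alpha> $ j)) has_derivative
    (\<lambda>v. \<Sum>j\<in>UNIV. of_int (\<alpha> $ j) * (\<Prod>i\<in>UNIV. (z $ i) powi (\<alpha> $ i)) * (v $ j / z $ j))) (at z)"
proof -
  have nz: "z $ j \<noteq> 0" for j using assms by (simp add: torus_def)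
  have "((\<lambda>z. (z $ j) powi (\<alpha> $ j)) has_derivative
      (\<lambda>v. v $ j * (of_int (\<alpha> $ j) * (z $ j) powi (\<alpha> $ j - 1)))) (at z)" for j
    by (intro has_derivative_power_int nz bounded_linear_imp_has_derivative bounded_linear_vec_nth)
  then have "((\<lambda>z. \<Prod>j\<in>UNIV. (z $ j) powi (\<alpha> $ j)) has_derivative
      (\<lambda>v. \<Sum>j\<in>UNIV. v $ j * (of_int (\<alpha> $ j) * (z $ j) powi (\<alpha> $ j - 1)) *
        (\<Prod>i\<in>UNIV - {j}. (z $ i) powi (\<alpha> $ i)))) (at z)"
    by (intro has_derivative_prod)
  moreover have "v $ j * (of_int (\<alpha> $ j) * (z $ j) powi (\<alpha> $ j - 1)) * (\<Prod>i\<in>UNIV - {j}. (z $ i) powi (\<alpha> $ i))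
      = of_int (\<alpha> $ j) * (\<Prod>i\<in>UNIV. (z $ i) powi (\<alpha> $ i)) * (v $ j / z $ j)" for v j
    by (simp add: prod.remove[of UNIV j] power_int_diff nz)
  ultimately show ?thesis by simp
qed

lemma has_derivative_leval:
  assumes "z \<in> torus"
  shows "(leval f has_derivative (\<lambda>v. \<Sum>j\<in>UNIV. leval (euler_op j f) z * (v $ j / z $ j))) (at z)"
proof -
  let ?m = "\<lambda>\<alpha>. \<Prod>i\<in>UNIV. (z $ i) powi (\<alpha> $ i)"
  have "((\<lambda>z. leval f z) has_derivative
      (\<lambda>v. \<Sum>\<alpha>\<in>Poly_Mapping.keys f. Poly_Mapping.lookup f \<alpha> * (\<Sum>j\<in>UNIV. of_int (\<alpha> $ j) * ?m \<alpha> * (v $ j / z $ j)))) (at z)"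
    unfolding leval_def
    by (intro has_derivative_sum has_derivative_mult_right has_derivative_monomial assms)
  moreover have "(\<Sum>\<alpha>\<in>Poly_Mapping.keys f. Poly_Mapping.lookup f \<alpha> * (\<Sum>j\<in>UNIV. of_int (\<alpha> $ j) * ?m \<alpha> * (v $ j / z $ j)))
      = (\<Sum>j\<in>UNIV. leval (euler_op j f) z * (v $ j / z $ j))" for v
    unfolding leval_euler_op sum_distrib_left sum_distrib_right
    by (subst sum.swap) (simp add: mult_ac)
  ultimately show ?thesis by simp
qed

lemma log_partial_eq_leval_euler_op:
  assumes "z \<in> torus"
  shows "log_partial f j z = leval (euler_op j f) z"
proof -
  have nz: "z $ j \<noteq> 0" using assms by (simp add: torus_def)
  let ?line = "\<lambda>w. \<chi> i. if i = j then w else z $ i"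
  have line: "?line w = z + axis j (w - z $ j)" for w
    by (simp add: vec_eq_iff axis_def)
  have "bounded_linear (axis j :: complex \<Rightarrow> complex ^ 'a)"
    by (rule linear_conv_bounded_linear[THEN iffD1], rule linearI) (auto simp: vec_eq_iff axis_def)
  then have "(?line has_derivative axis j) (at (z $ j))"
    unfolding line
    by (auto intro!: derivative_eq_intros bounded_linear.has_derivative[of "axis j"])
  moreover have "?line (z $ j) = z" by (simp add: vec_eq_iff)
  ultimately have "((\<lambda>w. leval f (?line w)) has_derivative
      (\<lambda>h. \<Sum>i\<in>UNIV. leval (euler_op i f) z * (axis j h $ i / z $ i))) (at (z $ j))"
    using has_derivative_compose[of ?line "axis j" "z $ j" UNIV "leval f"] has_derivative_leval[OF assms, of f]
    by simp
  moreover have "(\<lambda>h. \<Sum>i\<in>UNIV. leval (euler_op i f) z * (axis j h $ i / z $ i)) = (*) (leval (euler_op j f) z / z $ j)"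
    by (rule ext) (simp add: axis_def if_distrib if_distribR sum.delta cong: if_cong)
  ultimately have "((\<lambda>w. leval f (?line w)) has_field_derivative leval (euler_op j f) z / z $ j) (at (z $ j))"
    by (simp add: has_field_derivative_def)
  then have "partial j f z = leval (euler_op j f) z / z $ j"
    unfolding partial_def by (rule DERIV_imp_deriv)
  then show ?thesis using nz by (simp add: log_partial_def)
qed

text \<open>In the logarithmic tangent coordinates \<open>w\<^sub>j = v\<^sub>j / z\<^sub>j\<close> the tangent space is the complex
  hyperplane \<open>\<Sum> F\<^sub>j w\<^sub>j = 0\<close>. Smoothness enters here: one nonzero complex partial derivative
  makes the real derivative of \<open>f\<close> onto \<open>\<complex>\<close>.\<close>

lemma tangent_space_hypersurface:
  assumes "smooth_hypersurface f" "z \<in> hypersurface f"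
  shows "tangent_space (hypersurface f) z = {v. (\<Sum>j\<in>UNIV. log_partial f j z * (v $ j / z $ j)) = 0}"
proof -
  define D where "D x = Blinfun (\<lambda>v. \<Sum>j\<in>UNIV. leval (euler_op j f) x * (v $ j / x $ j))" for x
  have D: "blinfun_apply (D x) = (\<lambda>v. \<Sum>j\<in>UNIV. leval (euler_op j f) x * (v $ j / x $ j))" for x
    unfolding D_def
    by (intro bounded_linear_Blinfun_apply bounded_linear_sum bounded_linear_const_mult
        bounded_linear_compose[OF bounded_linear_divide bounded_linear_vec_nth])
  have z: "z \<in> torus" "leval f z = 0" using assms(2) by (auto simp: hypersurface_def)
  obtain l where "partial l f z \<noteq> 0"
    using assms by (auto simp: smooth_hypersurface_def)
  moreover have nzl: "z $ l \<noteq> 0" using z by (simp add: torus_def)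
  ultimately have l: "leval (euler_op l f) z \<noteq> 0"
    using log_partial_eq_leval_euler_op[OF z(1), of f l] by (auto simp: log_partial_def)
  have der: "(leval f has_derivative blinfun_apply (D x)) (at x)" if "x \<in> torus" for x
    unfolding D using that by (rule has_derivative_leval)
  have contl: "continuous_on torus (leval g)" for g :: "'a laurent"
    using has_derivative_leval
    by (meson continuous_at_imp_continuous_on has_derivative_continuous)
  have cont: "continuous_on torus D"
    by (rule continuous_on_blinfun_componentwise)
      (auto simp: D torus_def intro!: continuous_intros contl[unfolded torus_def])
  have "surj (blinfun_apply (D z))"
  proof (rule surjI)
    fix b
    show "blinfun_apply (D z) (axis l (z $ l * b / leval (euler_op l f) z)) = b"
      using l nzl by (simp add: D axis_def if_distrib if_distribR sum.delta cong: if_cong)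
  qed
  from tangent_space_regular_zero_set[OF open_torus der cont z this]
  show ?thesis
    using z(1) by (simp add: hypersurface_def D log_partial_eq_leval_euler_op)
qed

section \<open>The differential of the logarithmic map\<close>

lemma has_derivative_Log:
  assumes "z \<in> torus"
  shows "(Log has_derivative (\<lambda>v. \<chi> j. Re (v $ j / z $ j))) (at z)"
proof -
  have nz: "z $ j \<noteq> 0" for j using assms by (simp add: torus_def)
  have "((\<lambda>z. ln (cmod (z $ j))) has_derivative (\<lambda>v. Re (v $ j / z $ j))) (at z)" for j
  proof -
    have "((\<lambda>z. z $ j) has_derivative (\<lambda>v. v $ j)) (at z)"
      by (intro bounded_linear_imp_has_derivative bounded_linear_vec_nth)
    from has_derivative_ln[OF _ has_derivative_compose[OF this has_derivative_norm]] nz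
    have "((\<lambda>z. ln (cmod (z $ j))) has_derivative (\<lambda>v. inner (v $ j) (sgn (z $ j)) * inverse (cmod (z $ j)))) (at z)"
      by simp
    moreover have "inner (v $ j) (sgn (z $ j)) * inverse (cmod (z $ j)) = Re (v $ j / z $ j)" for v
    proof -
      have "Re (v $ j / z $ j) = inner (v $ j) (z $ j) / (cmod (z $ j))\<^sup>2"
        by (simp add: Re_divide inner_complex_def cmod_power2)
      then show ?thesis
        by (simp add: sgn_div_norm power2_eq_square divide_inverse mult_ac)
    qed
    ultimately show ?thesis by simp
  qed
  then have "\<And>j. ((\<lambda>z. Log z $ j) has_derivative (\<lambda>v. (\<chi> j. Re (v $ j / z $ j)) $ j)) (at z)"
    by (simp add: Log_def)
  then show ?thesis
    by (subst has_derivative_componentwise_within) (auto simp: Basis_vec_def inner_axis)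
qed

text \<open>The differential of \<open>Log\<close> takes real parts of the logarithmic tangent coordinates.
  This reduces criticality to linear algebra: whether the real parts of the vectors of a complex
  hyperplane fill \<open>\<real>\<^sup>n\<close>.\<close>

lemma critical_locus_Log_iff:
  assumes "smooth_hypersurface f" "z \<in> hypersurface f"
  shows "z \<in> critical_locus Log (hypersurface f) \<longleftrightarrow>
    \<not> (\<forall>x::real ^ 'n::finite. \<exists>w::complex ^ 'n. (\<Sum>j\<in>UNIV. log_partial f j z * w $ j) = 0 \<and> (\<forall>j. Re (w $ j) = x $ j))"
proof -
  have z: "z \<in> torus" using assms(2) by (simp add: hypersurface_def)
  have nz: "z $ j \<noteq> 0" for j using z by (simp add: torus_def)
  have Df: "frechet_derivative Log (at z) = (\<lambda>v. \<chi> j. Re (v $ j / z $ j))"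
    using frechet_derivative_at[OF has_derivative_Log[OF z]] by simp
  have *: "x \<in> frechet_derivative Log (at z) ` tangent_space (hypersurface f) z \<longleftrightarrow>
      (\<exists>w::complex ^ 'n. (\<Sum>j\<in>UNIV. log_partial f j z * w $ j) = 0 \<and> (\<forall>j. Re (w $ j) = x $ j))" for x
  proof
    assume "x \<in> frechet_derivative Log (at z) ` tangent_space (hypersurface f) z"
    then obtain v where "(\<Sum>j\<in>UNIV. log_partial f j z * (v $ j / z $ j)) = 0" "x = (\<chi> j. Re (v $ j / z $ j))"
      unfolding tangent_space_hypersurface[OF assms] Df by auto
    then show "\<exists>w::complex ^ 'n. (\<Sum>j\<in>UNIV. log_partial f j z * w $ j) = 0 \<and> (\<forall>j. Re (w $ j) = x $ j)"
      by (intro exI[of _ "\<chi> j. v $ j / z $ j"]) simp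
  next
    assume "\<exists>w::complex ^ 'n. (\<Sum>j\<in>UNIV. log_partial f j z * w $ j) = 0 \<and> (\<forall>j. Re (w $ j) = x $ j)"
    then obtain w :: "complex ^ 'n" where "(\<Sum>j\<in>UNIV. log_partial f j z * w $ j) = 0" "\<And>j. Re (w $ j) = x $ j"
      by blast
    then show "x \<in> frechet_derivative Log (at z) ` tangent_space (hypersurface f) z"
      unfolding tangent_space_hypersurface[OF assms] Df
      by (intro image_eqI[of _ _ "\<chi> j. z $ j * w $ j"]) (auto simp: nz vec_eq_iff)
  qed
  then show ?thesis
    using assms(2) by (simp add: critical_locus_def set_eq_iff)
qed

section \<open>Complex vectors proportional to real vectors\<close>

text \<open>\<open>Im (a * cnj b)\<close> is, up to sign, the determinant of \<open>a, b\<close> as vectors of \<open>\<real>\<^sup>2\<close>. If it is not \<open>0\<close>,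
  they form a real basis of \<open>\<complex>\<close>, and the coordinates are given by Cramer's rule.\<close>

lemma complex_eq_real_combination:
  assumes "Im (a * cnj b) \<noteq> 0"
  obtains s t :: real where "c = of_real s * a + of_real t * b"
proof
  define d where "d = Im (a * cnj b)"
  define p where "p = Im (c * cnj b)"
  define r where "r = - Im (c * cnj a)"
  have "of_real d * c = of_real p * a + of_real r * b"
    by (simp add: complex_eq_iff d_def p_def r_def algebra_simps)
  moreover have "d \<noteq> 0" using assms by (simp add: d_def)
  ultimately show "c = of_real (p / d) * a + of_real (r / d) * b"
    by (simp add: field_simps)
qed

text \<open>The real-valuedness of \<open>a\<^sub>j / a\<^sub>l\<close> is what the vanishing of \<open>Im (a\<^sub>j * cnj a\<^sub>l)\<close> expresses, as the two
  numbers differ by the positive factor \<open>\<bar>a\<^sub>l\<bar>\<^sup>2\<close>.\<close>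

lemma real_ratios_iff:
  fixes a :: "'n \<Rightarrow> complex"
  assumes "a l \<noteq> 0"
  shows "(\<forall>j. Im (a j * cnj (a l)) = 0) \<longleftrightarrow> (\<exists>r::'n \<Rightarrow> real. \<forall>j. a j = of_real (r j) * a l)"
proof
  assume *: "\<forall>j. Im (a j * cnj (a l)) = 0"
  show "\<exists>r::'n \<Rightarrow> real. \<forall>j. a j = of_real (r j) * a l"
  proof (intro exI allI)
    fix j
    have "a j / a l = of_real (Re (a j / a l))"
      using * by (simp add: complex_eq_iff Im_complex_div_eq_0)
    then show "a j = of_real (Re (a j / a l)) * a l"
      using assms by (metis nonzero_divide_eq_eq)
  qed
next
  assume "\<exists>r::'n \<Rightarrow> real. \<forall>j. a j = of_real (r j) * a l"
  then obtain r :: "'n \<Rightarrow> real" where r: "\<And>j. a j = of_real (r j) * a l" by blast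
  show "\<forall>j. Im (a j * cnj (a l)) = 0"
  proof
    fix j
    have "a j * cnj (a l) = of_real (r j * (cmod (a l))\<^sup>2)"
      by (subst r) (simp add: complex_norm_square mult.assoc del: of_real_power)
    then show "Im (a j * cnj (a l)) = 0" by (metis Im_complex_of_real)
  qed
qed

text \<open>This is why \<open>n - 1\<close> equations suffice on an affine chart: if \<open>a\<^sub>j = r\<^sub>j a\<^sub>l\<close> for
  real \<open>r\<^sub>j\<close>, then \<open>a\<^sub>j * cnj a\<^sub>k = r\<^sub>j r\<^sub>k \<bar>a\<^sub>l\<bar>\<^sup>2\<close>.\<close>

lemma pairwise_real_iff_real_against:
  fixes a :: "'n \<Rightarrow> complex"
  assumes "a l \<noteq> 0"
  shows "(\<forall>j k. Im (a j * cnj (a k)) = 0) \<longleftrightarrow> (\<forall>j. Im (a j * cnj (a l)) = 0)"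
proof
  assume "\<forall>j. Im (a j * cnj (a l)) = 0"
  then obtain r :: "'n \<Rightarrow> real" where r: "\<And>j. a j = of_real (r j) * a l"
    using real_ratios_iff[of a l] assms by blast
  show "\<forall>j k. Im (a j * cnj (a k)) = 0"
  proof (intro allI)
    fix j k
    have "a j * cnj (a k) = of_real (r j * r k * (cmod (a l))\<^sup>2)"
      by (subst r[of j], subst r[of k]) (simp add: complex_norm_square mult_ac del: of_real_power)
    then show "Im (a j * cnj (a k)) = 0" by (metis Im_complex_of_real)
  qed
qed auto

text \<open>If the coefficients are real multiples \<open>r\<^sub>j a\<^sub>l\<close> of one of them, the hyperplane has the real equation
  \<open>\<Sum> r\<^sub>j w\<^sub>j = 0\<close>, which the real parts inherit. If two coefficients are linearly independent over
  \<open>\<real>\<close>, any real vector \<open>x\<close> can be completed by imaginary parts supported at these two positions,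
  because \<open>i (s a\<^sub>j + t a\<^sub>k)\<close> takes every complex value, in particular \<open>- \<Sum> a\<^sub>i x\<^sub>i\<close>.\<close>

lemma real_parts_of_hyperplane_UNIV_iff:
  fixes a :: "'n::finite \<Rightarrow> complex"
  assumes "a l \<noteq> 0"
  shows "(\<forall>x::real ^ 'n. \<exists>w::complex ^ 'n. (\<Sum>j\<in>UNIV. a j * w $ j) = 0 \<and> (\<forall>j. Re (w $ j) = x $ j))
    \<longleftrightarrow> \<not> (\<forall>j k. Im (a j * cnj (a k)) = 0)"
proof
  assume onto: "\<forall>x::real ^ 'n. \<exists>w::complex ^ 'n. (\<Sum>j\<in>UNIV. a j * w $ j) = 0 \<and> (\<forall>j. Re (w $ j) = x $ j)"
  show "\<not> (\<forall>j k. Im (a j * cnj (a k)) = 0)"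
  proof
    assume "\<forall>j k. Im (a j * cnj (a k)) = 0"
    then obtain r :: "'n \<Rightarrow> real" where r: "\<And>j. a j = of_real (r j) * a l"
      using real_ratios_iff[of a l] assms by blast
    obtain w :: "complex ^ 'n" where w: "(\<Sum>j\<in>UNIV. a j * w $ j) = 0" "\<And>j. Re (w $ j) = axis l 1 $ j"
      using onto by blast
    have "(\<Sum>j\<in>UNIV. a j * w $ j) = a l * (\<Sum>j\<in>UNIV. of_real (r j) * w $ j)"
      unfolding sum_distrib_left by (rule sum.cong[OF refl], subst r) (simp add: mult_ac)
    then have "Re (\<Sum>j\<in>UNIV. of_real (r j) * w $ j) = 0"
      using w(1) assms by simp
    then have "(\<Sum>j\<in>UNIV. r j * axis l 1 $ j) = 0" by (simp add: w(2))
    then have "r l = 0" by (simp add: axis_def if_distrib if_distribR sum.delta cong: if_cong)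
    then show False using r[of l] assms by simp
  qed
next
  assume "\<not> (\<forall>j k. Im (a j * cnj (a k)) = 0)"
  then obtain j k where jk: "Im (a j * cnj (a k)) \<noteq> 0" by blast
  then have "j \<noteq> k" by auto
  show "\<forall>x::real ^ 'n. \<exists>w::complex ^ 'n. (\<Sum>j\<in>UNIV. a j * w $ j) = 0 \<and> (\<forall>j. Re (w $ j) = x $ j)"
  proof
    fix x :: "real ^ 'n"
    define c where "c = (\<Sum>i\<in>UNIV. a i * of_real (x $ i))"
    obtain s t :: real where st: "\<i> * c = of_real s * a j + of_real t * a k"
      using complex_eq_real_combination[OF jk] by blast
    define y where "y i = (if i = j then s else 0) + (if i = k then t else 0)" for i
    define w :: "complex ^ 'n" where "w = (\<chi> i. Complex (x $ i) (y i))"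
    have "(\<Sum>i\<in>UNIV. a i * w $ i) = c + \<i> * (\<Sum>i\<in>UNIV. a i * of_real (y i))"
      by (simp add: c_def w_def Complex_eq algebra_simps sum.distrib sum_distrib_left)
    also have "(\<Sum>i\<in>UNIV. a i * of_real (y i)) = \<i> * c"
      unfolding st y_def
      by (simp add: of_real_add distrib_left sum.distrib if_distrib[of of_real] if_distrib[of "(*) _"]
          sum.delta mult.commute cong: if_cong)
    finally have "(\<Sum>i\<in>UNIV. a i * w $ i) = 0" by (simp flip: mult.assoc)
    then show "\<exists>w::complex ^ 'n. (\<Sum>j\<in>UNIV. a j * w $ j) = 0 \<and> (\<forall>j. Re (w $ j) = x $ j)"
      by (intro exI[of _ w]) (simp add: w_def)
  qed
qed

text \<open>A line has a real representative exactly if the ratios of its homogeneous coordinates are real;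
  dividing by the nonzero coordinate \<open>v\<^sub>l\<close> produces one.\<close>

lemma homog_in_real_proj_space_iff:
  fixes v :: "complex ^ 'n::finite"
  assumes "v $ l \<noteq> 0"
  shows "homog v \<in> real_proj_space \<longleftrightarrow> (\<forall>j k. Im (v $ j * cnj (v $ k)) = 0)"
proof
  have "v \<noteq> 0" using assms by auto
  assume "homog v \<in> real_proj_space"
  then obtain x :: "real ^ 'n" where x: "x \<noteq> 0" "homog v = homog (\<chi> j. complex_of_real (x $ j))"
    by (auto simp: real_proj_space_def)
  then have "(v, \<chi> j. complex_of_real (x $ j)) \<in> proj_rel"
    using eq_equiv_class_iff[OF equiv_proj_rel, of v "\<chi> j. complex_of_real (x $ j)"] \<open>v \<noteq> 0\<close>
    by (auto simp: homog_def vec_eq_iff)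
  then obtain c where c: "c \<noteq> 0" "(\<chi> j. complex_of_real (x $ j)) = c *s v"
    by (auto simp: proj_rel_def)
  have *: "c * v $ j = of_real (x $ j)" for j
    using arg_cong[OF c(2), of "\<lambda>u. u $ j"] by simp
  then have v: "v $ j = of_real (x $ j) * inverse c" for j
    using c(1) by (simp add: field_simps flip: *)
  have "v $ l \<noteq> 0" by fact
  then have xl: "x $ l \<noteq> 0" using v[of l] by auto
  have "\<forall>j. v $ j = of_real (x $ j / x $ l) * v $ l"
    using xl by (simp add: v)
  then have "\<forall>j. Im (v $ j * cnj (v $ l)) = 0"
    using real_ratios_iff[of "($) v", OF assms] by (meson)
  then show "\<forall>j k. Im (v $ j * cnj (v $ k)) = 0"
    using pairwise_real_iff_real_against[of "($) v", OF assms] by blast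
next
  have "v \<noteq> 0" using assms by auto
  assume "\<forall>j k. Im (v $ j * cnj (v $ k)) = 0"
  then obtain r :: "'n \<Rightarrow> real" where r: "\<And>j. v $ j = of_real (r j) * v $ l"
    using real_ratios_iff[of "($) v", OF assms] by blast
  have "r l = 1" using r[of l] assms by simp
  then have nz: "(\<chi> j. r j) \<noteq> 0" by (auto simp: vec_eq_iff intro!: exI[of _ l])
  have "(\<chi> j. complex_of_real (r j)) = inverse (v $ l) *s v"
    using assms by (simp add: vec_eq_iff) (subst r, simp)
  moreover have "(\<chi> j. complex_of_real (r j)) \<noteq> 0" using \<open>r l = 1\<close> by (auto simp: vec_eq_iff intro!: exI[of _ l])
  ultimately have "(v, \<chi> j. complex_of_real (r j)) \<in> proj_rel"
    using assms \<open>v \<noteq> 0\<close> unfolding proj_rel_def mem_Collect_eq prod.case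
    by (intro conjI exI[of _ "inverse (v $ l)"]) simp_all
  then have "homog v = homog (\<chi> j. complex_of_real (r j))"
    unfolding homog_def by (rule equiv_class_eq[OF equiv_proj_rel])
  then show "homog v \<in> real_proj_space"
    unfolding real_proj_space_def mem_Collect_eq using nz
    by (intro exI[of _ "\<chi> j. r j"]) simp
qed

section \<open>Rational functions in real coordinates\<close>

lemma polynomial_up_to_denominator_poly:
  "real_polynomial_function p \<Longrightarrow> polynomial_up_to_denominator T p"
  unfolding polynomial_up_to_denominator_def
  by (intro exI[of _ p] exI[of _ "\<lambda>_. 1"]) (simp add: real_polynomial_function.intros(2))

lemma polynomial_up_to_denominator_add:
  assumes "polynomial_up_to_denominator T g" "polynomial_up_to_denominator T h"
  shows "polynomial_up_to_denominator T (\<lambda>w. g w + h w)"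
proof -
  obtain p d p' d' where
    "real_polynomial_function p" "real_polynomial_function d" "\<forall>w\<in>T. d w \<noteq> 0 \<and> d w * g w = p w"
    "real_polynomial_function p'" "real_polynomial_function d'" "\<forall>w\<in>T. d' w \<noteq> 0 \<and> d' w * h w = p' w"
    using assms unfolding polynomial_up_to_denominator_def by metis
  then show ?thesis
    unfolding polynomial_up_to_denominator_def
    by (intro exI[of _ "\<lambda>w. p w * d' w + p' w * d w"] exI[of _ "\<lambda>w. d w * d' w"])
      (auto intro!: real_polynomial_function.intros(3,4) simp: algebra_simps)
qed

lemma polynomial_up_to_denominator_mult:
  assumes "polynomial_up_to_denominator T g" "polynomial_up_to_denominator T h"
  shows "polynomial_up_to_denominator T (\<lambda>w. g w * h w)"
proof -
  obtain p d p' d' where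
    "real_polynomial_function p" "real_polynomial_function d" "\<forall>w\<in>T. d w \<noteq> 0 \<and> d w * g w = p w"
    "real_polynomial_function p'" "real_polynomial_function d'" "\<forall>w\<in>T. d' w \<noteq> 0 \<and> d' w * h w = p' w"
    using assms unfolding polynomial_up_to_denominator_def by metis
  moreover from this have "d w * d' w \<noteq> 0 \<and> d w * d' w * (g w * h w) = p w * p' w" if "w \<in> T" for w
    using that by (metis (no_types, lifting) mult.assoc mult.commute mult_eq_0_iff)
  ultimately show ?thesis
    unfolding polynomial_up_to_denominator_def
    by (intro exI[of _ "\<lambda>w. p w * p' w"] exI[of _ "\<lambda>w. d w * d' w"])
      (simp add: real_polynomial_function.intros(4))
qed

lemma polynomial_up_to_denominator_diff:
  assumes "polynomial_up_to_denominator T g" "polynomial_up_to_denominator T h"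
  shows "polynomial_up_to_denominator T (\<lambda>w. g w - h w)"
  using polynomial_up_to_denominator_add[OF assms(1) polynomial_up_to_denominator_mult[OF
      polynomial_up_to_denominator_poly[OF real_polynomial_function.intros(2)[of "-1"]] assms(2)]]
  by simp

lemma polynomial_up_to_denominator_cong:
  "(\<And>w. w \<in> T \<Longrightarrow> g w = h w) \<Longrightarrow> polynomial_up_to_denominator T g \<longleftrightarrow> polynomial_up_to_denominator T h"
  by (simp add: polynomial_up_to_denominator_def)

definition Re_Im_polynomial ::
    "'a::real_normed_vector set \<Rightarrow> ('a \<Rightarrow> complex) \<Rightarrow> bool" where
  "Re_Im_polynomial T g \<longleftrightarrow> polynomial_up_to_denominator T (\<lambda>w. Re (g w)) \<and>
     polynomial_up_to_denominator T (\<lambda>w. Im (g w))"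

lemma Re_Im_polynomial_const: "Re_Im_polynomial T (\<lambda>_. c)"
  by (simp add: Re_Im_polynomial_def polynomial_up_to_denominator_poly real_polynomial_function.intros(2))

lemma Re_Im_polynomial_mult:
  "Re_Im_polynomial T g \<Longrightarrow> Re_Im_polynomial T h \<Longrightarrow> Re_Im_polynomial T (\<lambda>w. g w * h w)"
  by (simp add: Re_Im_polynomial_def polynomial_up_to_denominator_add
      polynomial_up_to_denominator_diff polynomial_up_to_denominator_mult)

lemma Re_Im_polynomial_sum:
  "finite A \<Longrightarrow> (\<And>a. a \<in> A \<Longrightarrow> Re_Im_polynomial T (g a)) \<Longrightarrow> Re_Im_polynomial T (\<lambda>w. \<Sum>a\<in>A. g a w)"
  by (induction A rule: finite_induct)
    (auto simp: Re_Im_polynomial_const Re_Im_polynomial_def polynomial_up_to_denominator_add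
      polynomial_up_to_denominator_poly real_polynomial_function.intros(2))

lemma Re_Im_polynomial_prod:
  "finite A \<Longrightarrow> (\<And>a. a \<in> A \<Longrightarrow> Re_Im_polynomial T (g a)) \<Longrightarrow> Re_Im_polynomial T (\<lambda>w. \<Prod>a\<in>A. g a w)"
  by (induction A rule: finite_induct) (auto simp: Re_Im_polynomial_const Re_Im_polynomial_mult)

lemma Re_Im_polynomial_power:
  "Re_Im_polynomial T g \<Longrightarrow> Re_Im_polynomial T (\<lambda>w. g w ^ n)"
  by (induction n) (auto simp: Re_Im_polynomial_const Re_Im_polynomial_mult)

lemma Re_Im_polynomial_cnj:
  assumes "Re_Im_polynomial T g"
  shows "Re_Im_polynomial T (\<lambda>w. cnj (g w))"
  using assms polynomial_up_to_denominator_diff[of T "\<lambda>_. 0" "\<lambda>w. Im (g w)"]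
  by (simp add: Re_Im_polynomial_def polynomial_up_to_denominator_poly real_polynomial_function.intros(2))

lemma real_polynomial_function_coordinates:
  "real_polynomial_function (\<lambda>w :: (real \<times> real) ^ 'n::finite. fst (w $ j))"
  "real_polynomial_function (\<lambda>w :: (real \<times> real) ^ 'n::finite. snd (w $ j))"
  by (intro real_polynomial_function.intros(1) bounded_linear_compose[OF bounded_linear_fst bounded_linear_vec_nth]
      bounded_linear_compose[OF bounded_linear_snd bounded_linear_vec_nth])+

lemma Re_Im_polynomial_coordinate: "Re_Im_polynomial T (\<lambda>w. of_real_coords w $ j)"
  by (simp add: Re_Im_polynomial_def of_real_coords_def polynomial_up_to_denominator_poly
      real_polynomial_function_coordinates)

text \<open>The only denominators that occur are the \<open>x\<^sub>j\<^sup>2 + y\<^sub>j\<^sup>2\<close>, from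
  \<open>1 / (x + i y) = (x - i y) / (x\<^sup>2 + y\<^sup>2)\<close>.\<close>

lemma Re_Im_polynomial_inverse_coordinate:
  "Re_Im_polynomial real_torus (\<lambda>w :: (real \<times> real) ^ 'n::finite. inverse (of_real_coords w $ j))"
proof -
  let ?x = "\<lambda>w :: (real \<times> real) ^ 'n. fst (w $ j)" and ?y = "\<lambda>w :: (real \<times> real) ^ 'n. snd (w $ j)"
  let ?d = "\<lambda>w. (?x w)\<^sup>2 + (?y w)\<^sup>2"
  note coord = real_polynomial_function_coordinates[of j]
  have d: "real_polynomial_function ?d"
    by (intro real_polynomial_function.intros(3) real_polynomial_function_power coord)
  have nz: "?d w \<noteq> 0" if "w \<in> real_torus" for w
    using that by (auto simp: real_torus_def prod_eq_iff sum_power2_eq_zero_iff)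
  have "polynomial_up_to_denominator real_torus (\<lambda>w. ?x w / ?d w)"
    unfolding polynomial_up_to_denominator_def using d nz coord(1)
    by (intro exI[of _ ?x] exI[of _ ?d]) simp
  moreover have "polynomial_up_to_denominator real_torus (\<lambda>w. - ?y w / ?d w)"
    unfolding polynomial_up_to_denominator_def using d nz real_polynomial_function_minus[OF coord(2)]
    by (intro exI[of _ "\<lambda>w. - ?y w"] exI[of _ ?d]) simp
  ultimately show ?thesis
    by (simp add: Re_Im_polynomial_def of_real_coords_def)
qed

lemma Re_Im_polynomial_leval: "Re_Im_polynomial real_torus (\<lambda>w. leval f (of_real_coords w))"
proof -
  have "Re_Im_polynomial real_torus (\<lambda>w. of_real_coords w $ j powi k)" for j :: 'a and k
    unfolding power_int_def
    by (cases "k \<ge> 0")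
      (simp_all add: Re_Im_polynomial_power Re_Im_polynomial_coordinate Re_Im_polynomial_inverse_coordinate)
  then show ?thesis
    unfolding leval_def
    by (intro Re_Im_polynomial_sum Re_Im_polynomial_mult Re_Im_polynomial_const Re_Im_polynomial_prod) auto
qed

lemma real_algebraic_subset_zero_set:
  assumes "finite G" "\<And>g. g \<in> G \<Longrightarrow> polynomial_up_to_denominator T g"
  shows "real_algebraic_subset T {w \<in> T. \<forall>g\<in>G. g w = 0}"
proof -
  have "\<forall>g\<in>G. \<exists>p. real_polynomial_function p \<and> (\<forall>w\<in>T. g w = 0 \<longleftrightarrow> p w = 0)"
  proof
    fix g assume "g \<in> G"
    then obtain p d where "real_polynomial_function p" "\<forall>w\<in>T. d w \<noteq> 0 \<and> d w * g w = p w"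
      using assms(2) unfolding polynomial_up_to_denominator_def by blast
    then show "\<exists>p. real_polynomial_function p \<and> (\<forall>w\<in>T. g w = 0 \<longleftrightarrow> p w = 0)"
      by (intro exI[of _ p]) (metis mult_eq_0_iff)
  qed
  then obtain p where p: "\<forall>g\<in>G. real_polynomial_function (p g) \<and> (\<forall>w\<in>T. g w = 0 \<longleftrightarrow> p g w = 0)"
    by metis
  then show ?thesis
    unfolding real_algebraic_subset_def using assms(1)
    by (intro exI[of _ "p ` G"]) auto
qed

section \<open>Equations of the critical locus\<close>

lemma of_real_coords_in_torus_iff: "of_real_coords w \<in> torus \<longleftrightarrow> w \<in> real_torus"
  by (auto simp: torus_def real_torus_def of_real_coords_def complex_eq_iff prod_eq_iff)

lemma pairwise_real_iff_less:
  fixes a :: "'n::linorder \<Rightarrow> complex"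
  shows "(\<forall>j k. Im (a j * cnj (a k)) = 0) \<longleftrightarrow> (\<forall>j k. j < k \<longrightarrow> Im (a j * cnj (a k)) = 0)"
proof
  assume less: "\<forall>j k. j < k \<longrightarrow> Im (a j * cnj (a k)) = 0"
  show "\<forall>j k. Im (a j * cnj (a k)) = 0"
  proof (intro allI)
    fix j k
    have "Im (a j * cnj (a k)) = - Im (a k * cnj (a j))" by simp
    then show "Im (a j * cnj (a k)) = 0"
      using less by (cases j k rule: linorder_cases) (auto simp del: times_complex.sel)
  qed
qed blast

lemma cnj_antisymmetrisation_eq_0_iff: "a * cnj b - cnj a * b = 0 \<longleftrightarrow> Im (a * cnj b) = 0"
  by (auto simp: complex_eq_iff algebra_simps)

lemma log_partial_nonzero:
  assumes "smooth_hypersurface f" "z \<in> hypersurface f"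
  obtains l where "log_partial f l z \<noteq> 0"
  using assms
  by (auto simp: smooth_hypersurface_def hypersurface_def torus_def log_partial_def)

text \<open>The central equivalence, from which the projective, the real algebraic and the chart
  descriptions follow.\<close>

theorem critical_locus_Log_iff_pairwise_real:
  assumes "smooth_hypersurface f" "z \<in> hypersurface f"
  shows "z \<in> critical_locus Log (hypersurface f) \<longleftrightarrow>
    (\<forall>j k. Im (log_partial f j z * cnj (log_partial f k z)) = 0)"
proof -
  obtain l where "log_partial f l z \<noteq> 0" using log_partial_nonzero[OF assms] .
  from real_parts_of_hyperplane_UNIV_iff[of "\<lambda>j. log_partial f j z", OF this]
  show ?thesis by (simp add: critical_locus_Log_iff[OF assms])
qed

theorem theorem1p1:
  fixes f :: "'n::{finite,linorder} laurent"
    and V \<Sigma> :: "(complex ^ 'n::{finite,linorder}) set"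
    and F :: "'n \<Rightarrow> complex ^ 'n::{finite,linorder} \<Rightarrow> complex"
    and \<Sigma>\<^sub>R :: "((real \<times> real) ^ 'n::{finite,linorder}) set"
  assumes smooth: "smooth_hypersurface f"
  defines "V \<equiv> hypersurface f"
    and "\<Sigma> \<equiv> critical_locus Log V"
    and "F \<equiv> log_partial f"
    and "\<Sigma>\<^sub>R \<equiv> of_real_coords -` \<Sigma>"
  shows "(\<Sigma> = {q \<in> V. log_gauss f q \<in> real_proj_space})
     \<and> (\<forall>q\<in>V. q \<in> \<Sigma> \<longleftrightarrow>
           (\<forall>j k. j < k \<longrightarrow> F j q * cnj (F k q) - cnj (F j q) * F k q = 0))
     \<and> (\<Sigma>\<^sub>R = {w \<in> real_torus. Re (leval f (of_real_coords w)) = 0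
                   \<and> Im (leval f (of_real_coords w)) = 0
                   \<and> (\<forall>j k. j < k \<longrightarrow>
                        Im (F j (of_real_coords w) * cnj (F k (of_real_coords w))) = 0)})
     \<and> (polynomial_up_to_denominator real_torus (\<lambda>w. Re (leval f (of_real_coords w))))
     \<and> (polynomial_up_to_denominator real_torus (\<lambda>w. Im (leval f (of_real_coords w))))
     \<and> (\<forall>j k. j < k \<longrightarrow> polynomial_up_to_denominator real_torus
           (\<lambda>w. Im (F j (of_real_coords w) * cnj (F k (of_real_coords w)))))
     \<and> (real_algebraic_subset real_torus \<Sigma>\<^sub>R)
     \<and> (\<forall>l. \<Sigma> \<inter> {q \<in> V. F l q \<noteq> 0} =
           {q \<in> {q \<in> V. F l q \<noteq> 0}. \<forall>j. j \<noteq> l \<longrightarrow> Im (F j q * cnj (F l q)) = 0})"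
proof -
  have crit: "q \<in> \<Sigma> \<longleftrightarrow> (\<forall>j k. Im (F j q * cnj (F k q)) = 0)" if "q \<in> V" for q
    using critical_locus_Log_iff_pairwise_real[OF smooth] that by (simp add: V_def \<Sigma>_def F_def)
  have crit_less: "q \<in> \<Sigma> \<longleftrightarrow> (\<forall>j k. j < k \<longrightarrow> Im (F j q * cnj (F k q)) = 0)" if "q \<in> V" for q
    using crit[OF that] pairwise_real_iff_less[of "\<lambda>j. F j q"] by simp
  have \<Sigma>V: "\<Sigma> \<subseteq> V" by (auto simp: \<Sigma>_def critical_locus_def)
  have gauss: "log_gauss f q \<in> real_proj_space \<longleftrightarrow> q \<in> \<Sigma>" if q: "q \<in> V" for q
  proof -
    obtain l where "log_partial f l q \<noteq> 0"
      using log_partial_nonzero[OF smooth q[unfolded V_def]] .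
    then show ?thesis
      using homog_in_real_proj_space_iff[of "\<chi> j. log_partial f j q" l] crit[OF q]
      by (simp add: log_gauss_def F_def)
  qed
  have \<Sigma>\<^sub>R_eq: "\<Sigma>\<^sub>R = {w \<in> real_torus. Re (leval f (of_real_coords w)) = 0
                   \<and> Im (leval f (of_real_coords w)) = 0
                   \<and> (\<forall>j k. j < k \<longrightarrow>
                        Im (F j (of_real_coords w) * cnj (F k (of_real_coords w))) = 0)}" (is "_ = ?Z")
  proof (rule set_eqI)
    fix w
    have "of_real_coords w \<in> V \<longleftrightarrow> w \<in> real_torus \<and> Re (leval f (of_real_coords w)) = 0
        \<and> Im (leval f (of_real_coords w)) = 0"
      by (simp add: V_def hypersurface_def of_real_coords_in_torus_iff complex_eq_iff)
    then show "w \<in> \<Sigma>\<^sub>R \<longleftrightarrow> w \<in> ?Z"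
      using crit_less[of "of_real_coords w"] \<Sigma>V by (auto simp: \<Sigma>\<^sub>R_def)
  qed
  have poly_f: "polynomial_up_to_denominator real_torus (\<lambda>w. Re (leval f (of_real_coords w)))"
      "polynomial_up_to_denominator real_torus (\<lambda>w. Im (leval f (of_real_coords w)))"
    using Re_Im_polynomial_leval[of f] by (auto simp: Re_Im_polynomial_def)
  have poly_F: "polynomial_up_to_denominator real_torus
      (\<lambda>w. Im (F j (of_real_coords w) * cnj (F k (of_real_coords w))))" for j k
  proof -
    \<comment> \<open>On the torus \<open>F\<close> agrees with Laurent polynomials, and the claim concerns only points there.\<close>
    have "polynomial_up_to_denominator real_torus
        (\<lambda>w. Im (leval (euler_op j f) (of_real_coords w) * cnj (leval (euler_op k f) (of_real_coords w))))"
      using Re_Im_polynomial_mult[OF Re_Im_polynomial_leval[of "euler_op j f"]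
          Re_Im_polynomial_cnj[OF Re_Im_polynomial_leval[of "euler_op k f"]]]
      by (simp only: Re_Im_polynomial_def)
    then show ?thesis
      by (subst polynomial_up_to_denominator_cong)
        (simp_all add: F_def log_partial_eq_leval_euler_op of_real_coords_in_torus_iff)
  qed
  have algebraic: "real_algebraic_subset real_torus \<Sigma>\<^sub>R"
  proof -
    define G where "G = {\<lambda>w. Re (leval f (of_real_coords w)), \<lambda>w. Im (leval f (of_real_coords w))}
      \<union> (\<lambda>(j, k) w. Im (F j (of_real_coords w) * cnj (F k (of_real_coords w)))) ` {(j, k). j < k}"
    have "real_algebraic_subset real_torus {w \<in> real_torus. \<forall>g\<in>G. g w = 0}"
      by (rule real_algebraic_subset_zero_set) (use poly_f poly_F in \<open>auto simp: G_def\<close>)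
    moreover have "{w \<in> real_torus. \<forall>g\<in>G. g w = 0} = \<Sigma>\<^sub>R"
      unfolding \<Sigma>\<^sub>R_eq G_def by auto
    ultimately show ?thesis by simp
  qed
  have chart: "q \<in> \<Sigma> \<longleftrightarrow> (\<forall>j. j \<noteq> l \<longrightarrow> Im (F j q * cnj (F l q)) = 0)"
    if "q \<in> V" "F l q \<noteq> 0" for l q
    using pairwise_real_iff_real_against[of "\<lambda>j. F j q" l] crit[OF that(1)] that(2)
    by (metis Im_complex_of_real complex_norm_square)
  have "\<Sigma> = {q \<in> V. log_gauss f q \<in> real_proj_space}"
    using \<Sigma>V gauss by blast
  moreover have "\<forall>q\<in>V. q \<in> \<Sigma> \<longleftrightarrow>
      (\<forall>j k. j < k \<longrightarrow> F j q * cnj (F k q) - cnj (F j q) * F k q = 0)"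
    unfolding cnj_antisymmetrisation_eq_0_iff using crit_less by blast
  moreover have "\<forall>l. \<Sigma> \<inter> {q \<in> V. F l q \<noteq> 0} =
      {q \<in> {q \<in> V. F l q \<noteq> 0}. \<forall>j. j \<noteq> l \<longrightarrow> Im (F j q * cnj (F l q)) = 0}"
    using chart by blast
  moreover have "\<forall>j k. j < k \<longrightarrow> polynomial_up_to_denominator real_torus
      (\<lambda>w. Im (F j (of_real_coords w) * cnj (F k (of_real_coords w))))"
    using poly_F by simp
  moreover note \<Sigma>\<^sub>R_eq poly_f algebraic
  ultimately show ?thesis
    by (intro conjI)
qed

end
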